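(* Let $\mathcal{O}=(V,E)$ be an ontology, i.e., a directed acyclic graph with vertex set $V$ and edge set $E\subset V\times V$, and suppose ontological annotations are generated by a Bayesian network structured according to $\mathcal{O}$, as described in the context. Let $X$ be a non-empty set of all consistent subgraphs generated according to the probability distribution specified by the Bayesian network, and let $p\geq 1$ be a real parameter, with the possibility that $p=\infty$. Define $d_N^p:X\times X\to\mathbb{R}$ by $$d_N^p(F,G)=\frac{\big(ru(F,G)^p+mi(F,G)^p\big)^{1/p}}{\sum_{v\in F\cup G}ia(v)},$$ where $$mi(F,G)=\sum_{v\in F\setminus G}ia(v),\qquad ru(F,G)=\sum_{v\in G\setminus F}ia(v)$$ (for $p=\infty$, the numerator is the maximum of $ru(F,G)$ and $mi(F,G)$), with the convention $0/0:=0$. Then $(X,d_N^p)$ is a metric space. In addition, $d_N^p:X\times X\to[0,1]$.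
   Context: A consistent subgraph of $\mathcal{O}=(V,E)$ is a set $F\subseteq V$ such that if a vertex $v$ belongs to $F$, then all the ancestors of $v$ up to the root(s) of the ontology also belong to $F$. In the Bayesian network each vertex (concept) of the ontology is a binary random variable, and the graph structure specifies the conditional independence relationships. Each conditional probability table stores a single number $P(v\mid\mathrm{Parents}(v))$, the probability that $v$ is part of an annotation given that all of its parents are part of the annotation; if any parent of $v$ is not part of the annotation, then $v$ is guaranteed not to be in it. The marginal probability of a consistent subgraph $F$, where nodes not in $F$ are treated as unknown and marginalized over, is $P(F)=\prod_{v\in F}P(v\mid\mathrm{Parents}(v))$. The information accretion of $v$ is $ia(v)=-\log P(v\mid\mathrm{Parents}(v))$, so that the information content of $F$ is $\log\frac{1}{P(F)}=\sum_{v\in F}ia(v)$. A metric on $X$ is a function $d:X\times X\to\mathbb{R}$ that is nonnegative, symmetric, satisfies $d(a,b)=0$ if and only if $a=b$, and satisfies the triangle inequality. *)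

theory Defs
  imports "HOL-Probability.Probability"
begin

text \<open>An edge \<open>(u, v)\<close> points from the parent \<open>u\<close> to the child \<open>v\<close>.\<close>

definition ontology :: "'v set \<Rightarrow> ('v \<times> 'v) set \<Rightarrow> bool" where
  "ontology V E \<longleftrightarrow> finite V \<and> E \<subseteq> V \<times> V \<and> acyclic E"

definition parents :: "('v \<times> 'v) set \<Rightarrow> 'v \<Rightarrow> 'v set" where
  "parents E v = {u. (u, v) \<in> E}"

definition ancestors :: "('v \<times> 'v) set \<Rightarrow> 'v \<Rightarrow> 'v set" where
  "ancestors E v = {u. (u, v) \<in> E\<^sup>+}"

definition consistent_subgraph :: "'v set \<Rightarrow> ('v \<times> 'v) set \<Rightarrow> 'v set \<Rightarrow> bool" where
  "consistent_subgraph V E F \<longleftrightarrow> F \<subseteq> V \<and> (\<forall>v\<in>F. ancestors E v \<subseteq> F)"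

text \<open>
  A joint state of the binary variables attached to the vertices is encoded as the set
  \<open>F\<close> of vertices that are part of the annotation. The number \<open>\<theta> v\<close> is the entry
  \<open>P(v | Parents(v))\<close> of the conditional probability table of \<open>v\<close>, and
  \<open>cond_prob E \<theta> v F\<close> is the conditional probability of the state that \<open>v\<close> has in \<open>F\<close>
  given the states that the parents of \<open>v\<close> have in \<open>F\<close>.
\<close>

definition cond_prob :: "('v \<times> 'v) set \<Rightarrow> ('v \<Rightarrow> real) \<Rightarrow> 'v \<Rightarrow> 'v set \<Rightarrow> real" where
  "cond_prob E \<theta> v F =
     (if parents E v \<subseteq> F
      then (if v \<in> F then \<theta> v else 1 - \<theta> v)
      else (if v \<in> F then 0 else 1))"

text \<open>
  \<open>D\<close> is the law of the annotation: the joint distribution of all the binary variables, which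
  factorizes along the graph.
\<close>

definition bayesian_network ::
  "'v set \<Rightarrow> ('v \<times> 'v) set \<Rightarrow> ('v \<Rightarrow> real) \<Rightarrow> 'v set pmf \<Rightarrow> bool" where
  "bayesian_network V E \<theta> D \<longleftrightarrow>
     (\<forall>v\<in>V. 0 \<le> \<theta> v \<and> \<theta> v \<le> 1) \<and>
     set_pmf D \<subseteq> Pow V \<and>
     (\<forall>F. F \<subseteq> V \<longrightarrow> pmf D F = (\<Prod>v\<in>V. cond_prob E \<theta> v F))"

text \<open>
  The subgraphs that the network can generate. Full annotations are meant here (every vertex is
  either in or out), so that if \<open>\<theta> v = 1\<close> no generated subgraph contains all parents of \<open>v\<close>
  but not \<open>v\<close>, and if \<open>\<theta> v = 0\<close> no generated subgraph contains \<open>v\<close>.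
\<close>

definition generated_subgraphs ::
  "'v set \<Rightarrow> ('v \<times> 'v) set \<Rightarrow> 'v set pmf \<Rightarrow> 'v set set" where
  "generated_subgraphs V E D = {F. consistent_subgraph V E F \<and> F \<in> set_pmf D}"

text \<open>
  The value at \<open>\<theta> v = 0\<close>, where the information accretion is infinite, is immaterial: such a
  vertex lies in no generated subgraph. The base of the logarithm cancels in the normalized
  distance.
\<close>

definition ia :: "('v \<Rightarrow> real) \<Rightarrow> 'v \<Rightarrow> real" where
  "ia \<theta> v = - ln (\<theta> v)"

definition mi :: "('v \<Rightarrow> real) \<Rightarrow> 'v set \<Rightarrow> 'v set \<Rightarrow> real" where
  "mi \<theta> F G = (\<Sum>v\<in>F - G. ia \<theta> v)"

definition ru :: "('v \<Rightarrow> real) \<Rightarrow> 'v set \<Rightarrow> 'v set \<Rightarrow> real" where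
  "ru \<theta> F G = (\<Sum>v\<in>G - F. ia \<theta> v)"

text \<open>The convention \<open>0/0 = 0\<close> is that of HOL division.\<close>

definition d_N :: "('v \<Rightarrow> real) \<Rightarrow> ereal \<Rightarrow> 'v set \<Rightarrow> 'v set \<Rightarrow> real" where
  "d_N \<theta> p F G =
     (if p = \<infinity> then max (ru \<theta> F G) (mi \<theta> F G)
      else (ru \<theta> F G powr real_of_ereal p + mi \<theta> F G powr real_of_ereal p)
             powr (1 / real_of_ereal p))
     / (\<Sum>v\<in>F \<union> G. ia \<theta> v)"

text \<open>
  The locale \<open>Metric_space\<close> takes a distance on the whole type and demands nonnegativity and
  symmetry there, also outside the carrier. A distance on \<open>X\<close> is therefore extended by zero.
\<close>

definition dist_on :: "'a set \<Rightarrow> ('a \<Rightarrow> 'a \<Rightarrow> real) \<Rightarrow> 'a \<Rightarrow> 'a \<Rightarrow> real" where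
  "dist_on X d x y = (if x \<in> X \<and> y \<in> X then d x y else 0)"

end

theory Submission imports Defs
begin

text \<open>
  Write \<open>w\<close> for the weight of a set, \<open>U = w(A \<union> B)\<close>, \<open>c = w(C - (A \<union> B))\<close> and \<open>T = U + c\<close>,
  the weight of all three sets. Minkowski's inequality bounds the sum of the numerators for
  \<open>(A, C)\<close> and \<open>(C, B)\<close> from below by the norm of \<open>(x + c, y + c)\<close>, where \<open>(x, y)\<close> is the vector
  whose norm is the numerator for \<open>(A, B)\<close>. As \<open>x\<close> and \<open>y\<close> are at most \<open>U\<close>, this vector dominates
  \<open>(T / U) (x, y)\<close>; dividing by \<open>T\<close>, which is at least both denominators, gives the triangle
  inequality. Distinct generated subgraphs have positive distance because a vertex with
  \<open>\<theta> v = 1\<close> is present as soon as its parents are, so it cannot be a minimal element of their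
  symmetric difference.
\<close>

section \<open>The p-norm of a pair of nonnegative reals\<close>

text \<open>Absolute values are omitted since only nonnegative pairs occur. The case split copies
  that of \<open>d_N\<close>, so that \<open>d_N_eq_set_dist\<close> holds by unfolding.\<close>

definition pnorm :: "ereal \<Rightarrow> real \<Rightarrow> real \<Rightarrow> real" where
  "pnorm p x y =
     (if p = \<infinity> then max x y
      else (x powr real_of_ereal p + y powr real_of_ereal p) powr (1 / real_of_ereal p))"

lemma pnorm_commute: "pnorm p x y = pnorm p y x"
  by (simp add: pnorm_def max.commute add.commute)

lemma pnorm_nonneg:
  assumes "0 \<le> x" shows "0 \<le> pnorm p x y"
  using assms by (auto simp: pnorm_def)

lemma real_of_ereal_ge_1:
  assumes "1 \<le> p" "p \<noteq> \<infinity>" shows "1 \<le> real_of_ereal p"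
  using assms by (cases p) auto

lemma pnorm_mono:
  assumes "1 \<le> p" "0 \<le> x" "0 \<le> y" "x \<le> x'" "y \<le> y'"
  shows "pnorm p x y \<le> pnorm p x' y'"
proof (cases "p = \<infinity>")
  case False
  from real_of_ereal_ge_1[OF assms(1) False] show ?thesis
    using assms False by (auto simp: pnorm_def intro!: powr_mono2 add_mono)
qed (use assms in \<open>auto simp: pnorm_def\<close>)

lemma pnorm_scale:
  assumes "1 \<le> p" "0 \<le> k" "0 \<le> x" "0 \<le> y"
  shows "pnorm p (k * x) (k * y) = k * pnorm p x y"
proof (cases "p = \<infinity>")
  case True
  then show ?thesis using assms by (simp add: pnorm_def max_mult_distrib_left)
next
  case False
  define r where "r = real_of_ereal p"
  have "1 \<le> r" using real_of_ereal_ge_1[OF assms(1) False] by (simp add: r_def)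
  have "((k * x) powr r + (k * y) powr r) powr (1/r) = (k powr r * (x powr r + y powr r)) powr (1/r)"
    using assms by (simp add: powr_mult algebra_simps)
  also have "\<dots> = k * (x powr r + y powr r) powr (1/r)"
    using assms \<open>1 \<le> r\<close> by (simp add: powr_mult powr_powr)
  finally show ?thesis using False by (simp add: pnorm_def r_def)
qed

lemma pnorm_axis:
  assumes "1 \<le> p" "0 \<le> x"
  shows "pnorm p x 0 = x"
  using assms real_of_ereal_ge_1[OF assms(1)] by (auto simp: pnorm_def powr_powr)

text \<open>By monotonicity from the axes, each coordinate is at most the norm.\<close>

lemma pnorm_eq_0_iff:
  assumes "1 \<le> p" "0 \<le> x" "0 \<le> y"
  shows "pnorm p x y = 0 \<longleftrightarrow> x = 0 \<and> y = 0"
proof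
  assume *: "pnorm p x y = 0"
  have "x \<le> pnorm p x y"
    using pnorm_mono[of p x 0 x y] pnorm_axis[of p x] assms by simp
  moreover have "y \<le> pnorm p x y"
    using pnorm_mono[of p 0 y x y] pnorm_axis[of p y] pnorm_commute[of p y 0] assms by simp
  ultimately show "x = 0 \<and> y = 0" using * assms by simp
qed (use pnorm_axis[of p 0] assms in simp)

text \<open>For positive \<open>x\<close> and \<open>y\<close> this is convexity of the power
  function. If one of them is zero, it reduces to \<open>k powr r \<le> k\<close> for
  \<open>k\<close> in [0,1].\<close>

lemma powr_convex_combination:
  fixes r l x y :: real
  assumes "1 \<le> r" "0 \<le> l" "l \<le> 1" "0 \<le> x" "0 \<le> y"
  shows "(l * x + (1 - l) * y) powr r \<le> l * x powr r + (1 - l) * y powr r"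
proof -
  have zero: "(k * z) powr r \<le> k * z powr r" if "0 \<le> k" "k \<le> 1" "0 \<le> z" for k z
  proof -
    have "k powr r \<le> k powr 1" using that assms(1) by (intro powr_mono') auto
    then show ?thesis using that by (simp add: powr_mult mult_right_mono)
  qed
  consider "x = 0" | "y = 0" | "0 < x" "0 < y" using assms by linarith
  then show ?thesis
  proof cases
    case 3
    then show ?thesis
      using convex_onD[OF powr_convex[OF assms(1)], of "1 - l" x y] assms by simp
  qed (use zero[of l x] zero[of "1 - l" y] assms in auto)
qed

text \<open>Minkowski's inequality for finite \<open>p\<close>: the normalized pairs lie on the unit
  sphere, convexity of the power keeps their convex combinations in the unit ball, and scaling back
  gives the claim.\<close>

lemma pnorm_triangle:
  assumes "1 \<le> p" "0 \<le> a" "0 \<le> b" "0 \<le> c" "0 \<le> d"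
  shows "pnorm p (a + c) (b + d) \<le> pnorm p a b + pnorm p c d"
proof (cases "p = \<infinity>")
  case True
  then show ?thesis by (auto simp: pnorm_def)
next
  case False
  define r where "r = real_of_ereal p"
  define s where "s = pnorm p a b"
  define t where "t = pnorm p c d"
  have r: "1 \<le> r" using real_of_ereal_ge_1[OF assms(1) False] by (simp add: r_def)
  have powr_r: "pnorm p x y powr r = x powr r + y powr r" for x y
    using False r by (simp add: pnorm_def r_def powr_powr)
  consider "s = 0" | "t = 0" | "0 < s" "0 < t"
    using pnorm_nonneg[of a p b] pnorm_nonneg[of c p d] assms by (force simp: s_def t_def)
  then show ?thesis
  proof cases
    case 3
    \<comment> \<open>This weight makes the sum of the two pairs equal to \<open>s + t\<close> times
      a convex combination of the normalized pairs.\<close>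
    define l where "l = s / (s + t)"
    have l: "0 \<le> l" "l \<le> 1" and l': "1 - l = t / (s + t)"
      using 3 by (auto simp: l_def field_simps)
    have split: "u + v = (s + t) * (l * (u / s) + (1 - l) * (v / t))" for u v
    proof -
      have "(s + t) * l = s" "(s + t) * (1 - l) = t"
        using 3 unfolding l' by (auto simp: l_def)
      then show ?thesis
        using 3 by (simp add: distrib_left mult.assoc[symmetric])
    qed
    have unit: "(u / pnorm p u v) powr r + (v / pnorm p u v) powr r = 1"
      if "0 \<le> u" "0 \<le> v" "0 < pnorm p u v" for u v
    proof -
      have "u powr r + v powr r \<noteq> 0"
        using that unfolding powr_r[symmetric] by simp
      then show ?thesis
        by (simp add: powr_divide powr_r add_divide_distrib[symmetric])
    qed
    define A where "A = l * (a / s) + (1 - l) * (c / t)"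
    define B where "B = l * (b / s) + (1 - l) * (d / t)"
    have AB: "0 \<le> A" "0 \<le> B" using l 3 assms by (auto simp: A_def B_def)
    have "A powr r + B powr r \<le>
        l * ((a / s) powr r + (b / s) powr r) + (1 - l) * ((c / t) powr r + (d / t) powr r)"
      using powr_convex_combination[OF r l, of "a / s" "c / t"]
        powr_convex_combination[OF r l, of "b / s" "d / t"] 3 assms
      by (simp add: A_def B_def algebra_simps)
    also have "\<dots> = 1"
      using unit[of a b] unit[of c d] 3 assms by (simp add: s_def t_def)
    finally have "(A powr r + B powr r) powr (1 / r) \<le> 1 powr (1 / r)"
      using r by (intro powr_mono2) auto
    then have "pnorm p A B \<le> 1"
      using False by (simp add: pnorm_def r_def)
    moreover have "pnorm p (a + c) (b + d) = (s + t) * pnorm p A B"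
      unfolding split[of a c] split[of b d] A_def[symmetric] B_def[symmetric]
      using assms 3 AB by (intro pnorm_scale) auto
    ultimately show ?thesis
      using mult_left_mono[of "pnorm p A B" 1 "s + t"] 3 by (simp add: s_def t_def)
  \<comment> \<open>A pair of norm zero is the zero pair, so the sum is just the other pair.\<close>
  qed (use assms in \<open>auto simp: s_def t_def pnorm_eq_0_iff pnorm_nonneg\<close>)
qed

text \<open>Minkowski's inequality for \<open>(x, 0)\<close> and \<open>(0, y)\<close>.\<close>

lemma pnorm_le_add:
  assumes "1 \<le> p" "0 \<le> x" "0 \<le> y"
  shows "pnorm p x y \<le> x + y"
  using pnorm_triangle[of p x 0 0 y] pnorm_axis[of p x] pnorm_axis[of p y]
    pnorm_commute[of p 0 y] assms by simp

text \<open>The bound \<open>n \<le> u\<close> covers \<open>u = 0\<close>: then \<open>n = 0\<close>, and both sides vanish.\<close>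

lemma divide_le_divide_denominator:
  fixes n u t :: real
  assumes "0 \<le> n" "n \<le> u" "u \<le> t"
  shows "n / t \<le> n / u"
  using assms by (cases "u = 0") (auto intro!: divide_left_mono mult_pos_pos)

section \<open>The normalized distance for an arbitrary nonnegative weight\<close>

definition set_dist :: "ereal \<Rightarrow> ('v \<Rightarrow> real) \<Rightarrow> 'v set \<Rightarrow> 'v set \<Rightarrow> real" where
  "set_dist p w A B = pnorm p (sum w (B - A)) (sum w (A - B)) / sum w (A \<union> B)"

lemma d_N_eq_set_dist: "d_N \<theta> p = set_dist p (ia \<theta>)"
  by (intro ext) (simp add: d_N_def set_dist_def pnorm_def ru_def mi_def)

lemma set_dist_commute: "set_dist p w A B = set_dist p w B A"
  by (simp add: set_dist_def pnorm_commute Un_commute)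

context
  fixes V :: "'v set" and w :: "'v \<Rightarrow> real" and p :: ereal
  assumes fin: "finite V" and w: "\<forall>v\<in>V. 0 \<le> w v" and p: "1 \<le> p"
begin

lemma sum_mono_set: "A \<subseteq> B \<Longrightarrow> B \<subseteq> V \<Longrightarrow> sum w A \<le> sum w B"
  using fin w by (intro sum_mono2) (auto intro: finite_subset)

lemma sum_nonneg_set: "A \<subseteq> V \<Longrightarrow> 0 \<le> sum w A"
  using w by (intro sum_nonneg) auto

lemma sum_disjoint_Un: "A \<subseteq> V \<Longrightarrow> B \<subseteq> V \<Longrightarrow> A \<inter> B = {} \<Longrightarrow> sum w (A \<union> B) = sum w A + sum w B"
  using fin by (intro sum.union_disjoint) (auto intro: finite_subset)

lemma sum_Un_le: "A \<subseteq> V \<Longrightarrow> B \<subseteq> V \<Longrightarrow> sum w (A \<union> B) \<le> sum w A + sum w B"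
  using sum_disjoint_Un[of A "B - A"] sum_mono_set[of "B - A" B]
  by (simp add: subset_trans[OF Diff_subset])

text \<open>The p-norm is at most the 1-norm, which here is the weight of the symmetric difference.
  Besides the bound by 1, this shows that a zero denominator forces a zero numerator.\<close>

lemma set_dist_numerator_le:
  assumes "A \<subseteq> V" "B \<subseteq> V"
  shows "pnorm p (sum w (B - A)) (sum w (A - B)) \<le> sum w (A \<union> B)"
proof -
  have "pnorm p (sum w (B - A)) (sum w (A - B)) \<le> sum w (B - A) + sum w (A - B)"
    using assms p by (intro pnorm_le_add sum_nonneg_set) auto
  also have "\<dots> = sum w ((B - A) \<union> (A - B))"
    using assms by (intro sum_disjoint_Un[symmetric]) auto
  also have "\<dots> \<le> sum w (A \<union> B)"
    using assms by (intro sum_mono_set) auto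
  finally show ?thesis .
qed

lemma set_dist_nonneg:
  assumes "A \<subseteq> V" "B \<subseteq> V" shows "0 \<le> set_dist p w A B"
  unfolding set_dist_def using assms
  by (intro divide_nonneg_nonneg pnorm_nonneg sum_nonneg_set) auto

lemma set_dist_le_1:
  assumes "A \<subseteq> V" "B \<subseteq> V" shows "set_dist p w A B \<le> 1"
  unfolding set_dist_def using set_dist_numerator_le[OF assms] sum_nonneg_set[of "A \<union> B"] assms
  by (auto simp: divide_le_eq_1)

lemma set_dist_eq_0_iff:
  assumes "A \<subseteq> V" "B \<subseteq> V"
  shows "set_dist p w A B = 0 \<longleftrightarrow> (\<forall>v\<in>(A - B) \<union> (B - A). w v = 0)"
proof -
  have nn: "0 \<le> sum w (A - B)" "0 \<le> sum w (B - A)"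
    using assms by (auto intro!: sum_nonneg_set)
  have z: "sum w S = 0 \<longleftrightarrow> (\<forall>v\<in>S. w v = 0)" if "S \<subseteq> V" for S
    using that fin w by (intro sum_nonneg_eq_0_iff) (auto intro: finite_subset)
  \<comment> \<open>The bound on the numerator excludes a quotient that vanishes only through
    division by zero.\<close>
  have "set_dist p w A B = 0 \<longleftrightarrow> pnorm p (sum w (B - A)) (sum w (A - B)) = 0"
    using set_dist_numerator_le[OF assms] pnorm_nonneg[OF nn(2), of p "sum w (A - B)"]
    by (auto simp: set_dist_def)
  also have "\<dots> \<longleftrightarrow> sum w (B - A) = 0 \<and> sum w (A - B) = 0"
    using nn p by (intro pnorm_eq_0_iff)
  also have "\<dots> \<longleftrightarrow> (\<forall>v\<in>(A - B) \<union> (B - A). w v = 0)"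
    using assms z[of "A - B"] z[of "B - A"] by blast
  finally show ?thesis .
qed

lemma set_dist_triangle:
  assumes "A \<subseteq> V" "B \<subseteq> V" "C \<subseteq> V"
  shows "set_dist p w A B \<le> set_dist p w A C + set_dist p w C B"
proof (cases "sum w (A \<union> B) = 0")
  case True
  then show ?thesis
    using set_dist_nonneg[of A C] set_dist_nonneg[of C B] assms by (simp add: set_dist_def)
next
  case False
  define U where "U = sum w (A \<union> B)"
  define T where "T = sum w (A \<union> B \<union> C)"
  define c where "c = sum w (C - (A \<union> B))"
  define x where "x = sum w (B - A)"
  define y where "y = sum w (A - B)"
  let ?m = "pnorm p (sum w (C - A)) (sum w (A - C))"
  let ?n = "pnorm p (sum w (B - C)) (sum w (C - B))"
  have U: "0 < U" using False sum_nonneg_set[of "A \<union> B"] assms by (simp add: U_def)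
  have nn: "0 \<le> c" "0 \<le> x" "0 \<le> y"
    using assms by (auto simp: c_def x_def y_def intro!: sum_nonneg_set)
  have le: "x \<le> U" "y \<le> U"
    using assms by (auto simp: U_def x_def y_def intro!: sum_mono_set)
  have T: "T = U + c"
    using sum_disjoint_Un[of "A \<union> B" "C - (A \<union> B)"] assms
    by (auto simp: T_def U_def c_def)
  \<comment> \<open>An element of \<open>B - A\<close> lies in \<open>C - A\<close> or in
    \<open>B - C\<close>, according to whether it is in \<open>C\<close>. The extra elements counted
    by \<open>c\<close> lie in \<open>C - A\<close>.\<close>
  have xc: "x + c \<le> sum w (C - A) + sum w (B - C)"
  proof -
    have "x + c = sum w ((B - A) \<union> (C - (A \<union> B)))"
      using assms unfolding x_def c_def by (intro sum_disjoint_Un[symmetric]) auto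
    also have "\<dots> \<le> sum w ((C - A) \<union> (B - C))"
      using assms by (intro sum_mono_set) auto
    also have "\<dots> \<le> sum w (C - A) + sum w (B - C)"
      using assms by (intro sum_Un_le) auto
    finally show ?thesis .
  qed
  have yc: "y + c \<le> sum w (A - C) + sum w (C - B)"
  proof -
    have "y + c = sum w ((A - B) \<union> (C - (A \<union> B)))"
      using assms unfolding y_def c_def by (intro sum_disjoint_Un[symmetric]) auto
    also have "\<dots> \<le> sum w ((A - C) \<union> (C - B))"
      using assms by (intro sum_mono_set) auto
    also have "\<dots> \<le> sum w (A - C) + sum w (C - B)"
      using assms by (intro sum_Un_le) auto
    finally show ?thesis .
  qed
  have "(T / U) * pnorm p x y = pnorm p ((T / U) * x) ((T / U) * y)"
    using p U nn T by (intro pnorm_scale[symmetric]) auto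
  \<comment> \<open>Since \<open>T = U + c\<close>, the scaled coordinate is
    \<open>x + c * x / U\<close>, and \<open>x / U\<close> is at most 1; likewise for
    \<open>y\<close>.\<close>
  also have "\<dots> \<le> pnorm p (x + c) (y + c)"
    using U nn le T p mult_left_mono[OF le(1), of c] mult_left_mono[OF le(2), of c]
    by (intro pnorm_mono) (auto simp: field_simps)
  also have "\<dots> \<le> pnorm p (sum w (C - A) + sum w (B - C)) (sum w (A - C) + sum w (C - B))"
    using p nn xc yc by (intro pnorm_mono) auto
  also have "\<dots> \<le> ?m + ?n"
    using assms p by (intro pnorm_triangle sum_nonneg_set) auto
  finally have "pnorm p x y / U \<le> (?m + ?n) / T"
    using U T nn by (simp add: field_simps)
  also have "\<dots> \<le> set_dist p w A C + set_dist p w C B"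
    unfolding set_dist_def add_divide_distrib using assms
    by (intro add_mono divide_le_divide_denominator set_dist_numerator_le pnorm_nonneg
        sum_nonneg_set) (auto simp: T_def intro!: sum_mono_set)
  finally show ?thesis by (simp add: set_dist_def x_def y_def U_def)
qed

end

section \<open>Subgraphs generated by the Bayesian network\<close>

lemma consistent_parents:
  assumes "consistent_subgraph V E F" "v \<in> F" shows "parents E v \<subseteq> F"
  using assms by (auto simp: consistent_subgraph_def parents_def ancestors_def)

text \<open>A generated subgraph has nonzero probability, so no factor of its product
  vanishes.\<close>

lemma cond_prob_generated_nonzero:
  assumes "finite V" "bayesian_network V E \<theta> D" "F \<in> generated_subgraphs V E D" "v \<in> V"
  shows "cond_prob E \<theta> v F \<noteq> 0"
proof -
  have "pmf D F = (\<Prod>v\<in>V. cond_prob E \<theta> v F)" "pmf D F \<noteq> 0"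
    using assms by (auto simp: bayesian_network_def generated_subgraphs_def
        consistent_subgraph_def set_pmf_iff)
  then show ?thesis using assms(1,4) by auto
qed

text \<open>Consistency puts all parents of \<open>v\<close> into \<open>F\<close>, so the nonzero
  factor at \<open>v\<close> is \<open>\<theta> v\<close> itself.\<close>

lemma generated_theta_pos:
  assumes "finite V" "bayesian_network V E \<theta> D" "F \<in> generated_subgraphs V E D" "v \<in> F"
  shows "0 < \<theta> v" "\<theta> v \<le> 1"
proof -
  have cons: "consistent_subgraph V E F"
    using assms(3) by (simp add: generated_subgraphs_def)
  then have "v \<in> V" "parents E v \<subseteq> F"
    using consistent_parents[OF cons assms(4)] assms(4) by (auto simp: consistent_subgraph_def)
  moreover from this have "\<theta> v \<noteq> 0"
    using cond_prob_generated_nonzero[OF assms(1-3), of v] assms(4) by (auto simp: cond_prob_def)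
  ultimately show "0 < \<theta> v" "\<theta> v \<le> 1"
    using assms(2) by (auto simp: bayesian_network_def less_le)
qed

lemma generated_eqI:
  assumes "ontology V E" and bn: "bayesian_network V E \<theta> D"
    and F: "F \<in> generated_subgraphs V E D" and G: "G \<in> generated_subgraphs V E D"
    and one: "\<And>v. v \<in> (F - G) \<union> (G - F) \<Longrightarrow> \<theta> v = 1"
  shows "F = G"
proof (rule ccontr)
  assume "F \<noteq> G"
  have fin: "finite V" and E: "E \<subseteq> V \<times> V" "acyclic E"
    using assms(1) by (auto simp: ontology_def)
  have sub: "F \<subseteq> V" "G \<subseteq> V" and cons: "consistent_subgraph V E F" "consistent_subgraph V E G"
    using F G by (auto simp: generated_subgraphs_def consistent_subgraph_def)
  have "wf E"
    using E fin by (intro finite_acyclic_wf finite_subset[OF E(1)]) auto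
  moreover from \<open>F \<noteq> G\<close> obtain u where "u \<in> (F - G) \<union> (G - F)" by blast
  ultimately obtain v where v: "v \<in> (F - G) \<union> (G - F)"
      and min: "\<And>u. (u, v) \<in> E \<Longrightarrow> u \<notin> (F - G) \<union> (G - F)"
    by (rule wfE_min) blast
  \<comment> \<open>Each parent of \<open>v\<close> lies in whichever of \<open>F\<close> and
    \<open>G\<close> contains \<open>v\<close>. By minimality it is outside the symmetric
    difference, hence it lies in both.\<close>
  have par: "parents E v \<subseteq> F" "parents E v \<subseteq> G"
    using v min cons consistent_parents[of V E F v] consistent_parents[of V E G v]
    by (auto simp: parents_def)
  \<comment> \<open>The subgraph that omits \<open>v\<close> contributes the factor
    \<open>1 - \<theta> v\<close>, which is zero.\<close>
  have "cond_prob E \<theta> v F = 0 \<or> cond_prob E \<theta> v G = 0"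
    using v one[OF v] par by (auto simp: cond_prob_def)
  then show False
    using cond_prob_generated_nonzero[OF fin bn F] cond_prob_generated_nonzero[OF fin bn G] v sub
    by blast
qed

section \<open>The metric on the generated subgraphs\<close>

theorem theorem6p2:
  fixes V :: "'v set" and E :: "('v \<times> 'v) set" and \<theta> :: "'v \<Rightarrow> real"
    and D :: "'v set pmf" and X :: "'v set set" and p :: ereal
  assumes "ontology V E"
    and "bayesian_network V E \<theta> D"
    and "X = generated_subgraphs V E D"
    and "X \<noteq> {}"
    and "1 \<le> p"
  shows "Metric_space X (dist_on X (d_N \<theta> p)) \<and>
         (\<forall>F\<in>X. \<forall>G\<in>X. d_N \<theta> p F G \<in> {0..1})"
proof -
  \<comment> \<open>The weight lemmas are applied to the union of \<open>X\<close>, where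
    \<open>\<theta> v\<close> is positive and \<open>ia \<theta> v\<close> is the true information
    accretion. On all of \<open>V\<close>, \<open>\<theta> v\<close> may be 0.\<close>
  let ?V = "\<Union>X"
  have fin: "finite V" using assms(1) by (simp add: ontology_def)
  have "?V \<subseteq> V"
    using assms(3) by (auto simp: generated_subgraphs_def consistent_subgraph_def)
  then have fin': "finite ?V" using fin finite_subset by blast
  have \<theta>: "0 < \<theta> v" "\<theta> v \<le> 1" if "v \<in> ?V" for v
    using that generated_theta_pos[OF fin assms(2)] assms(3) by auto
  have ia: "\<forall>v\<in>?V. 0 \<le> ia \<theta> v"
    using \<theta> by (simp add: ia_def)
  note nonneg = set_dist_nonneg[OF fin' ia assms(5)]
    and le_1 = set_dist_le_1[OF fin' ia assms(5)]
    and eq_0 = set_dist_eq_0_iff[OF fin' ia assms(5)]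
    and triangle = set_dist_triangle[OF fin' ia assms(5)]
  have sub: "F \<subseteq> ?V" if "F \<in> X" for F using that by blast
  have eq: "set_dist p (ia \<theta>) F G = 0 \<longleftrightarrow> F = G" if FG: "F \<in> X" "G \<in> X" for F G
  proof
    assume "set_dist p (ia \<theta>) F G = 0"
    then have z: "\<forall>v\<in>(F - G) \<union> (G - F). ia \<theta> v = 0"
      using eq_0[OF sub sub] FG by blast
    show "F = G"
    proof (rule generated_eqI[OF assms(1,2)])
      show "F \<in> generated_subgraphs V E D" "G \<in> generated_subgraphs V E D"
        using FG assms(3) by auto
      fix v assume v: "v \<in> (F - G) \<union> (G - F)"
      \<comment> \<open>Positivity excludes the default value of the logarithm at 0, so that
        \<open>ln (\<theta> v) = 0\<close> yields \<open>\<theta> v = 1\<close>.\<close>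
      then have "0 < \<theta> v" using FG by (intro \<theta>) blast
      moreover have "ln (\<theta> v) = 0" using z v by (auto simp: ia_def)
      ultimately show "\<theta> v = 1" by simp
    qed
  next
    assume "F = G"
    then show "set_dist p (ia \<theta>) F G = 0"
      using eq_0[OF sub sub] FG by blast
  qed
  have "Metric_space X (dist_on X (set_dist p (ia \<theta>)))"
  proof
    fix F G H
    show "0 \<le> dist_on X (set_dist p (ia \<theta>)) F G"
      using nonneg[OF sub sub] by (auto simp: dist_on_def)
    show "dist_on X (set_dist p (ia \<theta>)) F G = dist_on X (set_dist p (ia \<theta>)) G F"
      by (auto simp: dist_on_def set_dist_commute)
    show "dist_on X (set_dist p (ia \<theta>)) F G = 0 \<longleftrightarrow> F = G" if "F \<in> X" "G \<in> X"
      using eq that by (auto simp: dist_on_def)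
    show "dist_on X (set_dist p (ia \<theta>)) F H
        \<le> dist_on X (set_dist p (ia \<theta>)) F G + dist_on X (set_dist p (ia \<theta>)) G H"
      if "F \<in> X" "G \<in> X" "H \<in> X"
      using triangle[OF sub sub sub] that by (auto simp: dist_on_def)
  qed
  then show ?thesis
    using nonneg[OF sub sub] le_1[OF sub sub] by (auto simp: d_N_eq_set_dist)
qed

end
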